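(* Suppose $f(x,\theta)$ is continuously differentiable in $x$ for all $\theta\in\Theta$ and $g$ is continuously differentiable. Suppose there are constants $G_{f,x},G_g>0$ such that $\|\nabla_x f(x_1,\theta)-\nabla_x f(x_2,\theta)\|\le G_{f,x}\|x_1-x_2\|$ for all $x_1,x_2\in X$, $\theta\in\Theta$, and $\nabla_\theta g$ is Lipschitz continuous with constant $G_g$. Suppose $f(\cdot,\theta)$ is strongly convex with constant $\eta_f>0$ for all $\theta\in\Theta$, and $g$ is strongly convex with constant $\eta_g>0$. Let $\theta^*$ be the minimizer of $g$ over $\Theta$ and $x^*$ the minimizer of $f(\cdot,\theta^* )$ over $X$, and suppose $\theta\mapsto\nabla_x f(x^*,\theta)$ is Lipschitz continuous on $\Theta$ with constant $L_\theta$. Let $\gamma_{f,k}=\gamma_f$ and $\gamma_{g,k}=\gamma_g$ for all $k$, where $0<\gamma_f<2/G_{f,x}$ and $0<\gamma_g<2/G_g$, and let $\{(x_k,\theta_k)\}$ be generated by the joint gradient scheme. Then for every $k\ge0$, $$\|x_{k+1}-x^*\|\le q_x^{k+1}\|x_0-x^*\|+(k+1)\,q_\theta\, q^k\,\|\theta_0-\theta^*\|,$$ where $q_x=(1-\gamma_f\eta_f(2-\gamma_f G_{f,x}))^{1/2}$, $q_\theta=\gamma_f L_\theta$, $q_g=(1-\gamma_g\eta_g(2-\gamma_g G_g))^{1/2}$ and $q=\max(q_x,q_g)$.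
   Context: $X\subseteq\mathbb{R}^n$ and $\Theta\subseteq\mathbb{R}^m$ are nonempty closed convex sets, $f:X\times\Theta\to\mathbb{R}$ is convex in $x$ for every $\theta\in\Theta$, and $g:\mathbb{R}^m\to\mathbb{R}$ is convex. $\Pi_Y$ denotes Euclidean projection onto $Y$. A differentiable function $h$ is strongly convex with constant $\eta$ if $(\nabla h(u)-\nabla h(v))^T(u-v)\ge\eta\|u-v\|^2$ for all $u,v$ in its domain of interest. The joint gradient scheme, given $x_0\in X$, $\theta_0\in\Theta$ and steplengths $\{\gamma_{f,k}\},\{\gamma_{g,k}\}$, is: for all $k\ge0$, $x_{k+1}=\Pi_X(x_k-\gamma_{f,k}\nabla_x f(x_k,\theta_k))$ and $\theta_{k+1}=\Pi_\Theta(\theta_k-\gamma_{g,k}\nabla_\theta g(\theta_k))$. *)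

theory Defs
  imports "HOL-Analysis.Analysis"
begin

(* The gradient is taken relative to S because f is only given on X x Theta.  At interior points
   of S (in particular for S = UNIV) this is the usual gradient, and a gradient of an extension of
   h to a neighbourhood of S is also one relative to S.  It need not be unique if S has empty
   interior, so gradient fields are passed as explicit parameters. *)
definition has_gradient_on ::
    "('a::euclidean_space \<Rightarrow> real) \<Rightarrow> ('a \<Rightarrow> 'a) \<Rightarrow> 'a set \<Rightarrow> bool" where
  "has_gradient_on h dh S \<longleftrightarrow>
     (\<forall>u\<in>S. (h has_derivative (\<lambda>d. dh u \<bullet> d)) (at u within S))"

definition C1_gradient_on ::
    "('a::euclidean_space \<Rightarrow> real) \<Rightarrow> ('a \<Rightarrow> 'a) \<Rightarrow> 'a set \<Rightarrow> bool" where
  "C1_gradient_on h dh S \<longleftrightarrow> has_gradient_on h dh S \<and> continuous_on S dh"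

definition strongly_convex_on ::
    "real \<Rightarrow> ('a::euclidean_space \<Rightarrow> real) \<Rightarrow> ('a \<Rightarrow> 'a) \<Rightarrow> 'a set \<Rightarrow> bool" where
  "strongly_convex_on \<eta> h dh S \<longleftrightarrow> has_gradient_on h dh S \<and>
     (\<forall>u\<in>S. \<forall>v\<in>S. (dh u - dh v) \<bullet> (u - v) \<ge> \<eta> * (norm (u - v))\<^sup>2)"

(* df x t is the partial gradient of f in its first argument; closest_point is the Euclidean
   projection. *)
definition joint_gradient_scheme ::
    "'a::euclidean_space set \<Rightarrow> 'b::euclidean_space set \<Rightarrow>
     ('a \<Rightarrow> 'b \<Rightarrow> 'a) \<Rightarrow> ('b \<Rightarrow> 'b) \<Rightarrow> (nat \<Rightarrow> real) \<Rightarrow> (nat \<Rightarrow> real) \<Rightarrow>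
     (nat \<Rightarrow> 'a) \<Rightarrow> (nat \<Rightarrow> 'b) \<Rightarrow> bool" where
  "joint_gradient_scheme X \<Theta> df dg \<gamma>f \<gamma>g x \<theta> \<longleftrightarrow>
     x 0 \<in> X \<and> \<theta> 0 \<in> \<Theta> \<and>
     (\<forall>k. x (Suc k) = closest_point X (x k - \<gamma>f k *\<^sub>R df (x k) (\<theta> k)) \<and>
          \<theta> (Suc k) = closest_point \<Theta> (\<theta> k - \<gamma>g k *\<^sub>R dg (\<theta> k)))"

end

theory Submission imports Defs begin

text \<open>
  Both recursions are instances of one estimate for a projected gradient step (lemma
  \<open>projected_step_bound\<close>), which rests on the cocoercivity
  \<open>\<parallel>\<nabla>h(u) - \<nabla>h(v)\<parallel>\<^sup>2 \<le> G (\<nabla>h(u) - \<nabla>h(v)) \<bullet> (u - v)\<close> of the gradient.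
  The usual proof of cocoercivity evaluates \<open>h\<close> at points that may lie outside \<open>X\<close>, where \<open>h\<close> is not
  defined. For nearby points of the relative interior it stays inside \<open>X\<close>; there it says that
  \<open>I - (2/G) \<nabla>h\<close> is nonexpansive, a property which propagates along segments by the triangle
  inequality and then to all of \<open>X\<close> by continuity. As \<open>X\<close> may have empty interior,
  \<open>\<nabla>h\<close> is first projected orthogonally onto the direction space of \<open>X\<close>; the component that is lost
  does not influence the projected step.
\<close>

section \<open>Gradient inequalities along segments of a convex set\<close>

lemma has_gradient_on_mvt:
  fixes h :: "'a::euclidean_space \<Rightarrow> real"
  assumes "has_gradient_on h dh X" "convex X" "u \<in> X" "v \<in> X"
  obtains t where "0 < t" "t < 1" "u + t *\<^sub>R (v - u) \<in> X"
    "h v - h u = dh (u + t *\<^sub>R (v - u)) \<bullet> (v - u)"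
proof -
  define p where "p = (\<lambda>t. u + t *\<^sub>R (v - u))"
  have pX: "p t \<in> X" if "t \<in> {0..1}" for t
    using convexD_alt[OF assms(2-4), of t] that by (simp add: p_def algebra_simps)
  have "((\<lambda>t. h (p t)) has_derivative (\<lambda>d. dh (p t) \<bullet> (d *\<^sub>R (v - u)))) (at t within {0..1})"
    if t: "0 \<le> t" "t \<le> 1" for t
  proof -
    have 1: "(p has_derivative (\<lambda>d. d *\<^sub>R (v - u))) (at t within {0..1})"
      unfolding p_def by (auto intro!: derivative_eq_intros)
    have "(h has_derivative (\<lambda>d. dh (p t) \<bullet> d)) (at (p t) within X)"
      using assms(1) pX[of t] t unfolding has_gradient_on_def by auto
    then have "(h has_derivative (\<lambda>d. dh (p t) \<bullet> d)) (at (p t) within p ` {0..1})"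
      by (rule has_derivative_subset) (use pX in auto)
    from diff_chain_within[OF 1 this] show ?thesis by (simp add: o_def)
  qed
  from mvt_simple[OF zero_less_one this]
  obtain t where "t \<in> {0<..<1}" "h (p 1) - h (p 0) = dh (p t) \<bullet> (v - u)" by auto
  then show ?thesis using that[of t] pX[of t] by (auto simp: p_def)
qed

text \<open>The mean value theorem is applied to \<open>h\<close> minus its quadratic model along
  the segment; Cauchy-Schwarz and the Lipschitz bound make the derivative nonpositive. Only points
  between \<open>u\<close> and \<open>v\<close> occur, so the argument stays inside
  \<open>X\<close>.\<close>

lemma gradient_upper_bound:
  fixes h :: "'a::euclidean_space \<Rightarrow> real"
  assumes grad: "has_gradient_on h dh X" and X: "convex X" "u \<in> X" "v \<in> X"
    and lip: "G-lipschitz_on X dh"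
  shows "h v \<le> h u + dh u \<bullet> (v - u) + G / 2 * (norm (v - u))\<^sup>2"
proof -
  define p where "p = (\<lambda>t. u + t *\<^sub>R (v - u))"
  define w where "w = v - u"
  have pX: "p t \<in> X" if "t \<in> {0..1}" for t
    using convexD_alt[OF X, of t] that by (simp add: p_def algebra_simps)
  define \<phi> where "\<phi> = (\<lambda>t. h (p t) - t * (dh u \<bullet> w) - G / 2 * t\<^sup>2 * (norm w)\<^sup>2)"
  have "(\<phi> has_derivative (\<lambda>d. d * (dh (p t) \<bullet> w - dh u \<bullet> w - G * t * (norm w)\<^sup>2)))
      (at t within {0..1})" if t: "0 \<le> t" "t \<le> 1" for t
  proof -
    have 1: "(p has_derivative (\<lambda>d. d *\<^sub>R w)) (at t within {0..1})"
      unfolding p_def w_def by (auto intro!: derivative_eq_intros)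
    have "(h has_derivative (\<lambda>d. dh (p t) \<bullet> d)) (at (p t) within X)"
      using grad pX[of t] t unfolding has_gradient_on_def by auto
    then have "(h has_derivative (\<lambda>d. dh (p t) \<bullet> d)) (at (p t) within p ` {0..1})"
      by (rule has_derivative_subset) (use pX in auto)
    from diff_chain_within[OF 1 this]
    have "((\<lambda>t. h (p t)) has_derivative (\<lambda>d. d * (dh (p t) \<bullet> w))) (at t within {0..1})"
      by (simp add: o_def)
    then show ?thesis unfolding \<phi>_def
      by (auto intro!: derivative_eq_intros simp: algebra_simps)
  qed
  from mvt_simple[OF zero_less_one this]
  obtain t where t: "t \<in> {0<..<1}"
    and eq: "\<phi> 1 - \<phi> 0 = dh (p t) \<bullet> w - dh u \<bullet> w - G * t * (norm w)\<^sup>2" by auto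
  have "(dh (p t) - dh u) \<bullet> w \<le> norm (dh (p t) - dh u) * norm w"
    by (rule norm_cauchy_schwarz)
  also have "\<dots> \<le> (G * norm (p t - u)) * norm w"
    using lipschitz_onD[OF lip pX[of t] X(2)] t by (auto simp: dist_norm intro!: mult_right_mono)
  also have "\<dots> = G * t * (norm w)\<^sup>2"
    using t by (simp add: p_def w_def power2_eq_square)
  finally have "\<phi> 1 \<le> \<phi> 0" using eq by (simp add: inner_diff_left)
  then show ?thesis by (simp add: \<phi>_def p_def w_def)
qed

text \<open>The mean value theorem turns the increment into a gradient at an intermediate point, and
  monotonicity compares that gradient with the one at \<open>u\<close>.\<close>

lemma gradient_lower_bound:
  fixes h :: "'a::euclidean_space \<Rightarrow> real"
  assumes grad: "has_gradient_on h dh X" and X: "convex X" "u \<in> X" "v \<in> X"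
    and mono: "\<And>a b. a \<in> X \<Longrightarrow> b \<in> X \<Longrightarrow> 0 \<le> (dh a - dh b) \<bullet> (a - b)"
  shows "h u + dh u \<bullet> (v - u) \<le> h v"
proof -
  obtain t where t: "0 < t" "t < 1" and pX: "u + t *\<^sub>R (v - u) \<in> X"
    and eq: "h v - h u = dh (u + t *\<^sub>R (v - u)) \<bullet> (v - u)"
    using has_gradient_on_mvt[OF grad X] by blast
  have "0 \<le> t * ((dh (u + t *\<^sub>R (v - u)) - dh u) \<bullet> (v - u))"
    using mono[OF pX X(2)] by simp
  with t eq show ?thesis by (simp add: zero_le_mult_iff inner_diff_left)
qed

text \<open>Moving from \<open>y\<close> a fraction \<open>t\<close> towards \<open>v\<close> cannot
  decrease \<open>h\<close>; the quadratic upper bound, divided by \<open>t\<close>, gives the claim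
  as \<open>t\<close> tends to \<open>0\<close> from the right.\<close>

lemma minimizer_variational_inequality:
  fixes h :: "'a::euclidean_space \<Rightarrow> real"
  assumes grad: "has_gradient_on h dh X" and X: "convex X"
    and lip: "G-lipschitz_on X dh"
    and min: "is_arg_min h (\<lambda>u. u \<in> X) y" and v: "v \<in> X"
  shows "0 \<le> dh y \<bullet> (v - y)"
proof -
  have y: "y \<in> X" and le: "\<And>z. z \<in> X \<Longrightarrow> h y \<le> h z"
    using min by (auto simp: is_arg_min_def not_less)
  have "- (G / 2 * t * (norm (v - y))\<^sup>2) \<le> dh y \<bullet> (v - y)" if t: "0 < t" "t \<le> 1" for t
  proof -
    have z: "y + t *\<^sub>R (v - y) \<in> X"
      using convexD_alt[OF X y v, of t] t by (simp add: algebra_simps)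
    have "0 \<le> t * (dh y \<bullet> (v - y)) + G / 2 * (t * norm (v - y))\<^sup>2"
      using gradient_upper_bound[OF grad X y z lip] le[OF z] t by simp
    also have "\<dots> = t * (dh y \<bullet> (v - y) + G / 2 * t * (norm (v - y))\<^sup>2)"
      by (simp add: power2_eq_square algebra_simps)
    finally show ?thesis using t by (simp add: zero_le_mult_iff)
  qed
  then have "\<forall>\<^sub>F t in at_right 0. - (G / 2 * t * (norm (v - y))\<^sup>2) \<le> dh y \<bullet> (v - y)"
    unfolding eventually_at_right_field by (intro exI[of _ 1]) auto
  moreover have "((\<lambda>t. - (G / 2 * t * (norm (v - y))\<^sup>2)) \<longlongrightarrow> - (G / 2 * 0 * (norm (v - y))\<^sup>2))
      (at_right 0)"
    by (intro tendsto_intros)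
  ultimately show ?thesis
    using tendsto_upperbound[of _ _ "at_right (0::real)"] by force
qed

section \<open>Orthogonal projection onto a subspace\<close>

lemma orthogonal_projection_exists:
  fixes V :: "'a::euclidean_space set"
  assumes "subspace V"
  obtains P where "linear P" "\<And>a. P a \<in> V" "\<And>a w. w \<in> V \<Longrightarrow> P a \<bullet> w = a \<bullet> w"
    "\<And>a. norm (P a) \<le> norm a"
proof -
  obtain B where B: "B \<subseteq> V" "pairwise orthogonal B" "\<And>b. b \<in> B \<Longrightarrow> norm b = 1"
      "independent B" "span B = V"
    using orthonormal_basis_subspace[OF assms] by metis
  have fin: "finite B" using B(4) by (rule independent_imp_finite)
  define P where "P = (\<lambda>a. \<Sum>b\<in>B. (a \<bullet> b) *\<^sub>R b)"
  have lin: "linear P" unfolding P_def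
    by (auto intro!: linearI simp: inner_add_left scaleR_add_left sum.distrib scaleR_sum_right)
  have PV: "P a \<in> V" for a unfolding P_def B(5)[symmetric]
    by (intro span_sum span_scale span_base)
  have Pb: "P a \<bullet> b = a \<bullet> b" if b: "b \<in> B" for a b
  proof -
    have "P a \<bullet> b = (\<Sum>c\<in>B. (a \<bullet> c) * (c \<bullet> b))"
      by (simp add: P_def inner_sum_left)
    also have "\<dots> = (\<Sum>c\<in>B. if c = b then a \<bullet> b else 0)"
      using B(2) B(3)[OF b] b
      by (intro sum.cong) (auto simp: pairwise_def orthogonal_def norm_eq_1)
    finally show ?thesis using fin b by simp
  qed
  have P: "P a \<bullet> w = a \<bullet> w" if "w \<in> V" for a w
    using that unfolding B(5)[symmetric]
  proof (induction rule: span_induct_alt)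
    case (step c b w)
    then show ?case by (simp add: inner_add_right Pb)
  qed simp
  have "norm (P a) \<le> norm a" for a
  proof -
    have "norm (P a) * norm (P a) = a \<bullet> P a"
      using P[OF PV] by (metis dot_square_norm power2_eq_square)
    also have "\<dots> \<le> norm a * norm (P a)" by (rule norm_cauchy_schwarz)
    finally show ?thesis
      by (cases "P a = 0") (simp_all add: mult_le_cancel_right)
  qed
  with lin PV P show ?thesis using that by blast
qed

section \<open>Nonexpansiveness of the reflected gradient map\<close>

text \<open>In the application \<open>V\<close> is the direction space of \<open>X\<close> and
  \<open>P\<close> the orthogonal projection onto it. How \<open>V\<close> relates to
  \<open>X\<close> is stated lemma by lemma.\<close>

locale projected_gradient =
  fixes X V :: "'a::euclidean_space set" and h :: "'a \<Rightarrow> real" and dh P :: "'a \<Rightarrow> 'a" and G :: real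
  assumes convex: "convex X" and grad: "has_gradient_on h dh X"
    and G: "G > 0" and lip: "G-lipschitz_on X dh"
    and mono: "\<And>a b. a \<in> X \<Longrightarrow> b \<in> X \<Longrightarrow> 0 \<le> (dh a - dh b) \<bullet> (a - b)"
    and V: "subspace V"
    and P: "linear P" "\<And>a. P a \<in> V" "\<And>a w. w \<in> V \<Longrightarrow> P a \<bullet> w = a \<bullet> w"
      "\<And>a. norm (P a) \<le> norm a"
begin

lemma norm_P_power2: "a \<bullet> P a = (norm (P a))\<^sup>2"
  using P(3)[OF P(2), of a a] by (simp add: dot_square_norm)

text \<open>The point in the last hypothesis minimises, over \<open>a + V\<close>, the quadratic
  upper bound at \<open>a\<close> for \<open>h\<close> minus its linear part at \<open>b\<close>.
  Comparing that bound with the lower bound at \<open>b\<close> yields the extra quadratic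
  term.\<close>

lemma half_cocoercive:
  assumes a: "a \<in> X" and b: "b \<in> X" and z: "a - (1 / G) *\<^sub>R P (dh a - dh b) \<in> X"
  shows "h b + dh b \<bullet> (a - b) + (norm (P (dh a - dh b)))\<^sup>2 / (2 * G) \<le> h a"
proof -
  let ?w = "P (dh a - dh b)" and ?z = "a - (1 / G) *\<^sub>R P (dh a - dh b)"
  have "h b + dh b \<bullet> (?z - b) \<le> h ?z"
    by (rule gradient_lower_bound[OF grad convex b z mono])
  moreover have "h ?z \<le> h a + dh a \<bullet> (?z - a) + G / 2 * (norm (?z - a))\<^sup>2"
    by (rule gradient_upper_bound[OF grad convex a z lip])
  moreover have "dh b \<bullet> (?z - b) = dh b \<bullet> (a - b) - (dh b \<bullet> ?w) / G"
    by (simp add: inner_diff_right)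
  moreover have "dh a \<bullet> (?z - a) = - ((dh a \<bullet> ?w) / G)" by simp
  moreover have "G / 2 * (norm (?z - a))\<^sup>2 = (norm ?w)\<^sup>2 / (2 * G)"
    using G by (simp add: power2_eq_square field_simps)
  moreover have "dh a \<bullet> ?w / G - dh b \<bullet> ?w / G = (norm ?w)\<^sup>2 / G"
    using norm_P_power2[of "dh a - dh b"] by (simp add: inner_diff_left flip: diff_divide_distrib)
  moreover have "(norm ?w)\<^sup>2 / G = 2 * ((norm ?w)\<^sup>2 / (2 * G))" by simp
  ultimately show ?thesis by linarith
qed

text \<open>This is the negative of the reflected operator \<open>2 T - I\<close> for
  \<open>T = (1 / G) P dh\<close>; \<open>T\<close> is firmly nonexpansive exactly when
  \<open>N\<close> is nonexpansive.\<close>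

definition N where "N a = a - (2 / G) *\<^sub>R P (dh a)"

lemma N_diff: "N a - N b = (a - b) - (2 / G) *\<^sub>R P (dh a - dh b)"
  by (simp add: N_def linear_diff[OF P(1)] algebra_simps)

text \<open>After expanding the square and cancelling, \<open>4 / G^2\<close> times the difference
  of the two sides of cocoercivity remains. As \<open>a - b\<close> lies in \<open>V\<close>,
  \<open>P\<close> drops out of the inner product.\<close>

lemma nonexpansive_iff_cocoercive:
  assumes "a - b \<in> V"
  shows "norm (N a - N b) \<le> norm (a - b) \<longleftrightarrow>
    (norm (P (dh a - dh b)))\<^sup>2 \<le> G * ((dh a - dh b) \<bullet> (a - b))"
proof -
  let ?w = "P (dh a - dh b)"
  have "(norm (N a - N b))\<^sup>2 = (norm (a - b))\<^sup>2 - 4 / G * (?w \<bullet> (a - b)) + 4 / G\<^sup>2 * (norm ?w)\<^sup>2"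
    unfolding N_diff power2_norm_eq_inner
    by (simp add: inner_diff_left inner_diff_right inner_commute power2_eq_square algebra_simps)
  also have "\<dots> = (norm (a - b))\<^sup>2 + 4 / G\<^sup>2 * ((norm ?w)\<^sup>2 - G * ((dh a - dh b) \<bullet> (a - b)))"
    using G P(3)[OF assms] by (simp add: power2_eq_square field_simps)
  finally have "(norm (N a - N b))\<^sup>2 \<le> (norm (a - b))\<^sup>2 \<longleftrightarrow>
      4 / G\<^sup>2 * ((norm ?w)\<^sup>2 - G * ((dh a - dh b) \<bullet> (a - b))) \<le> 0" by simp
  also have "\<dots> \<longleftrightarrow> (norm ?w)\<^sup>2 \<le> G * ((dh a - dh b) \<bullet> (a - b))"
    using mult_le_cancel_left_pos[of "4 / G\<^sup>2" "(norm ?w)\<^sup>2 - G * ((dh a - dh b) \<bullet> (a - b))" 0] G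
    by (simp del: times_divide_eq_left)
  finally show ?thesis by simp
qed

text \<open>The Lipschitz bound keeps the auxiliary steps of \<open>half_cocoercive\<close> no
  longer than \<open>e\<close>, hence inside \<open>X\<close>. Adding its two instances with
  \<open>a\<close> and \<open>b\<close> exchanged cancels the values of \<open>h\<close>.\<close>

lemma nonexpansive_local:
  assumes a: "a \<in> X" and b: "b \<in> X" and ab: "a - b \<in> V" "norm (a - b) \<le> e"
    and ball: "\<And>w. w \<in> V \<Longrightarrow> norm w \<le> e \<Longrightarrow> a + w \<in> X"
      "\<And>w. w \<in> V \<Longrightarrow> norm w \<le> e \<Longrightarrow> b + w \<in> X"
  shows "norm (N a - N b) \<le> norm (a - b)"
proof -
  let ?w = "P (dh a - dh b)"
  have w: "P (dh b - dh a) = - ?w"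
    using linear_neg[OF P(1), of "dh a - dh b"] by simp
  have "norm ?w \<le> norm (dh a - dh b)" by (rule P(4))
  also have "\<dots> \<le> G * norm (a - b)"
    using lipschitz_onD[OF lip a b] by (simp add: dist_norm)
  also have "\<dots> \<le> G * e" using G ab(2) by simp
  finally have "norm ((1 / G) *\<^sub>R ?w) \<le> e" using G by (simp add: field_simps)
  \<comment> \<open>The two auxiliary points move by opposite vectors, so both signs occur.\<close>
  moreover have wV: "(1 / G) *\<^sub>R ?w \<in> V" "- ((1 / G) *\<^sub>R ?w) \<in> V"
    using P(2) by (auto intro: subspace_scale[OF V] subspace_neg[OF V])
  ultimately have "a - (1 / G) *\<^sub>R ?w \<in> X" "b - (1 / G) *\<^sub>R P (dh b - dh a) \<in> X"
    using ball(1)[OF wV(2)] ball(2)[OF wV(1)] by (simp_all add: w)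
  from half_cocoercive[OF a b this(1)] half_cocoercive[OF b a this(2)]
  have "dh b \<bullet> (a - b) + dh a \<bullet> (b - a) + 2 * ((norm ?w)\<^sup>2 / (2 * G)) \<le> 0"
    unfolding w by simp
  moreover have "(dh a - dh b) \<bullet> (a - b) = - (dh b \<bullet> (a - b) + dh a \<bullet> (b - a))"
    by (simp add: inner_diff_left inner_diff_right)
  ultimately have "(norm ?w)\<^sup>2 / G \<le> (dh a - dh b) \<bullet> (a - b)" by simp
  then show ?thesis
    unfolding nonexpansive_iff_cocoercive[OF ab(1)] using G by (simp add: field_simps)
qed

text \<open>The segment is cut into equal pieces no longer than \<open>e\<close>. The local estimate
  holds on each, and the triangle inequality loses nothing on the right because the piece lengths
  add up to \<open>norm (v - u)\<close>.\<close>

lemma nonexpansive_inner: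
  assumes e: "e > 0" and uv: "v - u \<in> V"
    and ball: "\<And>w. w \<in> V \<Longrightarrow> norm w \<le> e \<Longrightarrow> u + w \<in> X"
      "\<And>w. w \<in> V \<Longrightarrow> norm w \<le> e \<Longrightarrow> v + w \<in> X"
  shows "norm (N v - N u) \<le> norm (v - u)"
proof -
  obtain n :: nat where n: "norm (v - u) / e < real n" using reals_Archimedean2 by blast
  have n0: "0 < real n" using n e by (smt (verit) divide_nonneg_pos norm_ge_zero)
  define p where "p = (\<lambda>i::nat. u + (real i / real n) *\<^sub>R (v - u))"
  \<comment> \<open>Shifting both endpoints by \<open>w\<close> shifts their convex combination by
    \<open>w\<close>, so the room of radius \<open>e\<close> persists along the segment.\<close>
  have pball: "p i + w \<in> X" if "i \<le> n" "w \<in> V" "norm w \<le> e" for i w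
  proof -
    have "(1 - real i / real n) *\<^sub>R (u + w) + (real i / real n) *\<^sub>R (v + w) \<in> X"
      using that n0 by (intro convexD_alt[OF convex] ball) auto
    then show ?thesis by (simp add: p_def algebra_simps)
  qed
  have p_step: "p (Suc i) - p i = (1 / real n) *\<^sub>R (v - u)" for i
    by (simp add: p_def add_divide_distrib algebra_simps)
  have step: "norm (N (p (Suc i)) - N (p i)) \<le> norm (v - u) / real n" if "i < n" for i
  proof -
    have "norm (N (p (Suc i)) - N (p i)) \<le> norm (p (Suc i) - p i)"
    proof (rule nonexpansive_local)
      have "norm (p (Suc i) - p i) = norm (v - u) / real n" by (simp add: p_step)
      then show "norm (p (Suc i) - p i) \<le> e" using n n0 e by (simp add: divide_le_eq less_divide_eq divide_less_eq mult.commute)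
      show "p (Suc i) - p i \<in> V" unfolding p_step by (rule subspace_scale[OF V uv])
      show "p (Suc i) \<in> X" using pball[of "Suc i" 0] that e subspace_0[OF V] by simp
      show "p i \<in> X" using pball[of i 0] that e subspace_0[OF V] by simp
    qed (use pball that in auto)
    then show ?thesis by (simp add: p_step)
  qed
  have "norm (N (p i) - N (p 0)) \<le> real i * (norm (v - u) / real n)" if "i \<le> n" for i
    using that
  proof (induction i)
    case (Suc i)
    have "norm (N (p (Suc i)) - N (p 0)) \<le>
        norm (N (p (Suc i)) - N (p i)) + norm (N (p i) - N (p 0))"
      by (rule order_trans[OF _ norm_triangle_ineq]) simp
    also have "\<dots> \<le> norm (v - u) / real n + real i * (norm (v - u) / real n)"
      using step[of i] Suc by (intro add_mono) auto
    finally show ?case by (simp add: algebra_simps add_divide_distrib)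
  qed simp
  from this[of n] show ?thesis using n0 by (simp add: p_def)
qed

text \<open>Pulling \<open>u\<close> and \<open>v\<close> slightly towards \<open>c\<close> gives
  both of them room in the directions of \<open>V\<close>; continuity of \<open>dh\<close> then
  permits the limit.\<close>

lemma nonexpansive:
  assumes e: "e > 0" and c: "\<And>w. w \<in> V \<Longrightarrow> norm w \<le> e \<Longrightarrow> c + w \<in> X"
    and dir: "\<And>a b. a \<in> X \<Longrightarrow> b \<in> X \<Longrightarrow> a - b \<in> V"
    and u: "u \<in> X" and v: "v \<in> X"
  shows "norm (N v - N u) \<le> norm (v - u)"
proof -
  define s where "s = (\<lambda>n. 1 / real (Suc n))"
  define p where "p = (\<lambda>a n. a + s n *\<^sub>R (c - a))"
  have s01: "0 < s n" "s n \<le> 1" for n by (simp_all add: s_def)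
  have s0: "s \<longlonglongrightarrow> 0" unfolding s_def by (rule LIMSEQ_Suc[OF lim_1_over_n])
  \<comment> \<open>The homothety with centre \<open>a\<close> and ratio \<open>s n\<close> carries
    the ball of radius \<open>e\<close> around \<open>c\<close> to one of radius
    \<open>s n * e\<close> around \<open>p a n\<close>.\<close>
  have pball: "p a n + w \<in> X" if "a \<in> X" "w \<in> V" "norm w \<le> s n * e" for a w n
  proof -
    have "(1 - s n) *\<^sub>R a + s n *\<^sub>R (c + (1 / s n) *\<^sub>R w) \<in> X"
      using that s01[of n]
      by (intro convexD_alt[OF convex] c subspace_scale[OF V]) (auto simp: field_simps)
    then show ?thesis using s01[of n] by (simp add: p_def algebra_simps)
  qed
  have pX: "p a n \<in> X" if "a \<in> X" for a n
    using pball[OF that, of 0 n] subspace_0[OF V] e s01[of n] by simp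
  have plim: "p a \<longlonglongrightarrow> a" for a
  proof -
    have "p a \<longlonglongrightarrow> a + 0 *\<^sub>R (c - a)" unfolding p_def by (intro tendsto_intros s0)
    then show ?thesis by simp
  qed
  have Nlim: "(\<lambda>n. N (p a n)) \<longlonglongrightarrow> N a" if "a \<in> X" for a
  proof -
    have "(\<lambda>n. dh (p a n)) \<longlonglongrightarrow> dh a"
      using lipschitz_on_continuous_on[OF lip] pX plim that
      by (auto simp: continuous_on_sequentially o_def)
    then show ?thesis unfolding N_def
      by (intro tendsto_diff tendsto_scaleR tendsto_const plim
          bounded_linear.tendsto[OF P(1)[unfolded linear_conv_bounded_linear]])
  qed
  have "norm (N (p v n) - N (p u n)) \<le> norm (p v n - p u n)" for n
  proof (rule nonexpansive_inner)
    show "0 < s n * e" using e s01 by simp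
    show "p v n - p u n \<in> V" by (rule dir[OF pX[OF v] pX[OF u]])
  qed (fact pball[OF u] pball[OF v])+
  then have "\<exists>m. \<forall>n\<ge>m. norm (N (p v n) - N (p u n)) \<le> norm (p v n - p u n)" by blast
  moreover have "(\<lambda>n. norm (N (p v n) - N (p u n))) \<longlonglongrightarrow> norm (N v - N u)"
    by (rule tendsto_norm[OF tendsto_diff[OF Nlim[OF v] Nlim[OF u]]])
  moreover have "(\<lambda>n. norm (p v n - p u n)) \<longlonglongrightarrow> norm (v - u)"
    by (rule tendsto_norm[OF tendsto_diff[OF plim plim]])
  ultimately show ?thesis using LIMSEQ_le by blast
qed

end

section \<open>Cocoercivity on the whole convex set\<close>

text \<open>A relative interior point \<open>c\<close> supplies the room, and \<open>V\<close> is
  the affine hull translated by \<open>- c\<close>. Only the agreement of \<open>P d\<close> with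
  \<open>d\<close> on differences of points of \<open>X\<close> is exported, which is what a
  projected step sees of \<open>d\<close>.\<close>

lemma gradient_cocoercive:
  fixes X :: "'a::euclidean_space set"
  assumes X: "convex X" "X \<noteq> {}" and grad: "has_gradient_on h dh X"
    and G: "G > 0" and lip: "G-lipschitz_on X dh"
    and mono: "\<And>a b. a \<in> X \<Longrightarrow> b \<in> X \<Longrightarrow> 0 \<le> (dh a - dh b) \<bullet> (a - b)"
  obtains P where
    "\<And>d a b. a \<in> X \<Longrightarrow> b \<in> X \<Longrightarrow> P d \<bullet> (a - b) = d \<bullet> (a - b)"
    "\<And>a b. a \<in> X \<Longrightarrow> b \<in> X \<Longrightarrow>
      (norm (P (dh a - dh b)))\<^sup>2 \<le> G * ((dh a - dh b) \<bullet> (a - b))"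
proof -
  obtain c where "c \<in> rel_interior X"
    using X rel_interior_eq_empty by blast
  then obtain e where c: "c \<in> X" and e: "e > 0" "cball c e \<inter> affine hull X \<subseteq> X"
    unfolding mem_rel_interior_cball by blast
  define V where "V = (\<lambda>x. - c + x) ` (affine hull X)"
  have V: "subspace V" unfolding V_def
    by (rule affine_diffs_subspace) (simp_all add: affine_affine_hull hull_inc[OF c])
  have dir: "a - b \<in> V" if "a \<in> X" "b \<in> X" for a b
  proof -
    have "- c + a \<in> V" "- c + b \<in> V" unfolding V_def using that by (auto intro: hull_inc)
    from subspace_diff[OF V this] show ?thesis by simp
  qed
  have cX: "c + w \<in> X" if "w \<in> V" "norm w \<le> e" for w
  proof -
    have "c + w \<in> affine hull X" using that(1) by (auto simp: V_def)
    moreover have "c + w \<in> cball c e" using that(2) by (simp add: dist_norm)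
    ultimately show ?thesis using e(2) by blast
  qed
  obtain P where P: "linear P" "\<And>a. P a \<in> V" "\<And>a w. w \<in> V \<Longrightarrow> P a \<bullet> w = a \<bullet> w"
    "\<And>a. norm (P a) \<le> norm a"
    using orthogonal_projection_exists[OF V] by blast
  interpret projected_gradient X V h dh P G
    by (rule projected_gradient.intro) (fact X(1) grad G lip mono V P)+
  show ?thesis
  proof (rule that)
    show "P d \<bullet> (a - b) = d \<bullet> (a - b)" if "a \<in> X" "b \<in> X" for d a b
      using P(3)[OF dir[OF that]] .
    show "(norm (P (dh a - dh b)))\<^sup>2 \<le> G * ((dh a - dh b) \<bullet> (a - b))"
      if "a \<in> X" "b \<in> X" for a b
      using nonexpansive[OF e(1) cX dir that(2) that(1)]
      unfolding nonexpansive_iff_cocoercive[OF dir[OF that]] by blast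
  qed
qed

section \<open>One projected gradient step\<close>

lemma strong_convexity_le_lipschitz:
  fixes X :: "'a::euclidean_space set"
  assumes strong: "strongly_convex_on \<eta> h dh X" and lip: "G-lipschitz_on X dh"
    and uv: "u \<in> X" "v \<in> X" "u \<noteq> v"
  shows "\<eta> \<le> G"
proof -
  have "\<eta> * (norm (u - v))\<^sup>2 \<le> (dh u - dh v) \<bullet> (u - v)"
    using strong uv unfolding strongly_convex_on_def by blast
  also have "\<dots> \<le> norm (dh u - dh v) * norm (u - v)" by (rule norm_cauchy_schwarz)
  also have "\<dots> \<le> G * norm (u - v) * norm (u - v)"
    using lipschitz_onD[OF lip uv(1,2)] by (intro mult_right_mono) (auto simp: dist_norm)
  finally show ?thesis using uv(3) by (simp add: power2_eq_square mult_le_cancel_right)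
qed

text \<open>
  A set with two distinct points is needed: on a singleton \<open>\<eta> > G\<close> is possible, and then the
  radicand may be negative, where Isabelle's \<open>sqrt\<close> is negative as well.
\<close>
lemma contraction_factor_nonneg:
  fixes X :: "'a::euclidean_space set"
  assumes strong: "strongly_convex_on \<eta> h dh X" and lip: "G-lipschitz_on X dh"
    and G: "G > 0" and \<gamma>: "0 < \<gamma>" "\<gamma> < 2 / G"
    and uv: "u \<in> X" "v \<in> X" "u \<noteq> v"
  shows "0 \<le> 1 - \<gamma> * \<eta> * (2 - \<gamma> * G)"
proof -
  have "0 < 2 - \<gamma> * G" using \<gamma> G by (simp add: field_simps)
  then have "\<gamma> * \<eta> * (2 - \<gamma> * G) \<le> \<gamma> * G * (2 - \<gamma> * G)"
    using strong_convexity_le_lipschitz[OF strong lip uv] \<gamma>(1) by simp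
  \<comment> \<open>With \<open>G\<close> in place of \<open>\<eta>\<close> the radicand is exactly
    this square.\<close>
  moreover have "0 \<le> (1 - \<gamma> * G)\<^sup>2" by simp
  ultimately show ?thesis by (simp add: power2_eq_square algebra_simps)
qed

text \<open>The vector \<open>c\<close> certifies optimality of \<open>y\<close> and may differ from
  \<open>dh y\<close>: in the \<open>x\<close> iteration, \<open>xs\<close> is optimal for
  \<open>\<theta>s\<close> while the step uses the current parameter. The last term is the price of
  this mismatch.\<close>

lemma projected_step_bound:
  fixes X :: "'a::euclidean_space set"
  assumes X: "convex X" "closed X" and strong: "strongly_convex_on \<eta> h dh X"
    and lip: "G-lipschitz_on X dh"
    and \<eta>: "\<eta> > 0" and G: "G > 0" and \<gamma>: "0 < \<gamma>" "\<gamma> < 2 / G"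
    and u: "u \<in> X" and y: "y \<in> X" and vi: "\<And>v. v \<in> X \<Longrightarrow> 0 \<le> c \<bullet> (v - y)"
  shows "norm (closest_point X (u - \<gamma> *\<^sub>R dh u) - y) \<le>
    sqrt (1 - \<gamma> * \<eta> * (2 - \<gamma> * G)) * norm (u - y) + \<gamma> * norm (dh y - c)"
proof -
  define r where "r = 1 - \<gamma> * \<eta> * (2 - \<gamma> * G)"
  define p where "p = closest_point X (u - \<gamma> *\<^sub>R dh u)"
  define d where "d = dh u - dh y"
  have pX: "p \<in> X" unfolding p_def using X u by (auto intro: closest_point_in_set)
  have grad: "has_gradient_on h dh X"
    and sc: "\<And>a b. a \<in> X \<Longrightarrow> b \<in> X \<Longrightarrow> \<eta> * (norm (a - b))\<^sup>2 \<le> (dh a - dh b) \<bullet> (a - b)"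
    using strong unfolding strongly_convex_on_def by auto
  have mono: "0 \<le> (dh a - dh b) \<bullet> (a - b)" if "a \<in> X" "b \<in> X" for a b
    by (rule order_trans[OF _ sc[OF that]]) (use \<eta> in simp)
  have "X \<noteq> {}" using u by blast
  then obtain P where P: "\<And>d a b. a \<in> X \<Longrightarrow> b \<in> X \<Longrightarrow> P d \<bullet> (a - b) = d \<bullet> (a - b)"
    and coco: "\<And>a b. a \<in> X \<Longrightarrow> b \<in> X \<Longrightarrow>
      (norm (P (dh a - dh b)))\<^sup>2 \<le> G * ((dh a - dh b) \<bullet> (a - b))"
    using gradient_cocoercive[OF X(1) _ grad G lip mono] by metis
  have s: "0 < 2 - \<gamma> * G" using \<gamma> G by (simp add: field_simps)
  have "(norm (u - y - \<gamma> *\<^sub>R P d))\<^sup>2 =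
      (norm (u - y))\<^sup>2 - 2 * \<gamma> * (P d \<bullet> (u - y)) + \<gamma>\<^sup>2 * (norm (P d))\<^sup>2"
    unfolding power2_norm_eq_inner
    by (simp add: inner_diff_left inner_diff_right inner_commute power2_eq_square algebra_simps)
  \<comment> \<open>Cocoercivity absorbs the quadratic term into the inner product; the remaining
    factor \<open>2 - \<gamma> * G\<close> is positive, so strong convexity can be used
    next.\<close>
  also have "\<dots> \<le> (norm (u - y))\<^sup>2 - 2 * \<gamma> * (d \<bullet> (u - y)) + \<gamma>\<^sup>2 * (G * (d \<bullet> (u - y)))"
    using coco[OF u y] P[OF u y] by (simp add: d_def mult_left_mono)
  also have "\<dots> = (norm (u - y))\<^sup>2 - \<gamma> * (2 - \<gamma> * G) * (d \<bullet> (u - y))"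
    by (simp add: power2_eq_square algebra_simps)
  also have "\<dots> \<le> (norm (u - y))\<^sup>2 - \<gamma> * (2 - \<gamma> * G) * (\<eta> * (norm (u - y))\<^sup>2)"
    using sc[OF u y] s \<gamma>(1) by (simp add: d_def mult_left_mono)
  also have "\<dots> = r * (norm (u - y))\<^sup>2" by (simp add: r_def algebra_simps)
  finally have "norm (u - y - \<gamma> *\<^sub>R P d) \<le> sqrt (r * (norm (u - y))\<^sup>2)"
    by (rule real_le_rsqrt)
  \<comment> \<open>\<open>sqrt\<close> is multiplicative on all reals, so this also covers a
    negative \<open>r\<close>, possible only if \<open>u = y\<close>.\<close>
  then have contr: "norm (u - y - \<gamma> *\<^sub>R P d) \<le> sqrt r * norm (u - y)"
    by (simp add: real_sqrt_mult)
  \<comment> \<open>The inequality characterising the projection, tested at \<open>y\<close>, is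
    added to the variational inequality of \<open>y\<close>, tested at \<open>p\<close>.\<close>
  have "(u - \<gamma> *\<^sub>R dh u - p) \<bullet> (y - p) \<le> 0"
    unfolding p_def by (rule closest_point_dot[OF X y])
  moreover have "0 \<le> \<gamma> * (c \<bullet> (p - y))" using vi[OF pX] \<gamma>(1) by simp
  ultimately have "(norm (p - y))\<^sup>2 \<le>
      (u - y) \<bullet> (p - y) - \<gamma> * (d \<bullet> (p - y)) + \<gamma> * ((c - dh y) \<bullet> (p - y))"
    unfolding power2_norm_eq_inner d_def
    by (simp add: inner_diff_left inner_diff_right inner_commute algebra_simps)
  \<comment> \<open>Both \<open>p\<close> and \<open>y\<close> lie in \<open>X\<close>, so
    \<open>d\<close> may be replaced by \<open>P d\<close>, for which the contraction was
    shown.\<close>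
  also have "\<dots> = (u - y - \<gamma> *\<^sub>R P d + \<gamma> *\<^sub>R (c - dh y)) \<bullet> (p - y)"
    using P[OF pX y, of d] by (simp add: inner_diff_left inner_add_left)
  also have "\<dots> \<le> norm (u - y - \<gamma> *\<^sub>R P d + \<gamma> *\<^sub>R (c - dh y)) * norm (p - y)"
    by (rule norm_cauchy_schwarz)
  finally have "norm (p - y) * norm (p - y) \<le>
      norm (u - y - \<gamma> *\<^sub>R P d + \<gamma> *\<^sub>R (c - dh y)) * norm (p - y)"
    by (simp add: power2_eq_square)
  then have "norm (p - y) \<le> norm (u - y - \<gamma> *\<^sub>R P d + \<gamma> *\<^sub>R (c - dh y))"
    by (cases "p = y") (simp_all add: mult_le_cancel_right)
  also have "\<dots> \<le> norm (u - y - \<gamma> *\<^sub>R P d) + norm (\<gamma> *\<^sub>R (c - dh y))"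
    by (rule norm_triangle_ineq)
  also have "\<dots> \<le> sqrt r * norm (u - y) + \<gamma> * norm (dh y - c)"
    using contr \<gamma>(1) by (simp add: norm_minus_commute)
  finally show ?thesis by (simp add: p_def r_def)
qed

section \<open>Coupled linear recursions\<close>

text \<open>For nonnegative factors, unrolling gives terms \<open>s * qx ^ (k - j) * b j\<close>
  with \<open>j \<le> k\<close>, each at most \<open>s * q ^ k * b 0\<close>; hence the factor
  \<open>Suc k\<close>. The sign alternatives admit a negative square root when the corresponding
  errors vanish.\<close>

lemma coupled_recursion_bound:
  fixes a b :: "nat \<Rightarrow> real"
  assumes a: "\<And>k. 0 \<le> a k" and b: "\<And>k. 0 \<le> b k" and s: "0 \<le> s"
    and a_Suc: "\<And>k. a (Suc k) \<le> qx * a k + s * b k"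
    and b_Suc: "\<And>k. b (Suc k) \<le> qg * b k"
    and qx: "0 \<le> qx \<or> (\<forall>k. a k = 0)" and qg: "0 \<le> qg \<or> b 0 = 0"
    and q: "q = max qx qg"
  shows "a (Suc k) \<le> qx ^ Suc k * a 0 + real (Suc k) * s * q ^ k * b 0"
proof -
  \<comment> \<open>For \<open>b 0 = 0\<close> the number \<open>q\<close> may be negative, so the
    vanishing of all \<open>b k\<close> is carried along separately.\<close>
  have bk: "b k \<le> q ^ k * b 0 \<and> (b 0 = 0 \<longrightarrow> b k = 0)" for k
  proof (induction k)
    case (Suc k)
    show ?case
    proof (cases "b 0 = 0")
      case True
      then show ?thesis using Suc b_Suc[of k] b[of "Suc k"] by simp
    next
      case False
      then have "0 \<le> qg" "qg \<le> q" using qg q by auto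
      have "b (Suc k) \<le> q * b k"
        using b_Suc[of k] mult_right_mono[OF \<open>qg \<le> q\<close> b[of k]] by linarith
      also have "\<dots> \<le> q * (q ^ k * b 0)"
        using Suc \<open>0 \<le> qg\<close> \<open>qg \<le> q\<close> by (intro mult_left_mono) auto
      finally show ?thesis using False by simp
    qed
  qed simp
  show ?thesis
  proof (cases "0 \<le> qx")
    case True
    then have q0: "0 \<le> q" "qx \<le> q" using q by auto
    show ?thesis
    proof (induction k)
      case 0
      then show ?case using a_Suc[of 0] by simp
    next
      case (Suc k)
      have "a (Suc (Suc k)) \<le> qx * a (Suc k) + s * b (Suc k)" by (rule a_Suc)
      also have "\<dots> \<le> qx * (qx ^ Suc k * a 0 + real (Suc k) * s * q ^ k * b 0)
          + s * (q ^ Suc k * b 0)"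
        using Suc True s bk[of "Suc k"] by (intro add_mono mult_left_mono) auto
      also have "\<dots> = qx ^ Suc (Suc k) * a 0 + qx * (real (Suc k) * s * q ^ k * b 0)
          + s * (q ^ Suc k * b 0)"
        by (simp add: algebra_simps)
      \<comment> \<open>Raising one factor \<open>qx\<close> to \<open>q\<close> gives the
        \<open>Suc k\<close> old terms the power \<open>q ^ Suc k\<close>, matching the one new
        term.\<close>
      also have "\<dots> \<le> qx ^ Suc (Suc k) * a 0 + q * (real (Suc k) * s * q ^ k * b 0)
          + s * (q ^ Suc k * b 0)"
        using q0 s b by (intro add_mono mult_right_mono order_refl mult_nonneg_nonneg) auto
      finally show ?case by (simp add: algebra_simps)
    qed
  next
    case False
    then have "a k = 0" for k using qx by blast
    \<comment> \<open>The left side is zero here, so nonnegativity of this term remains; if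
      \<open>b 0 \<noteq> 0\<close>, then \<open>q\<close> is nonnegative through
      \<open>qg\<close>.\<close>
    moreover have "0 \<le> real (Suc k) * s * q ^ k * b 0"
    proof (cases "b 0 = 0")
      case False
      then have "0 \<le> q" using qg q by auto
      then show ?thesis using s b by simp
    qed simp
    ultimately show ?thesis by simp
  qed
qed

section \<open>Error bound for the joint gradient scheme\<close>

theorem proposition4:
  fixes X :: "(real ^ 'n) set" and \<Theta> :: "(real ^ 'm) set"
    and f :: "real ^ 'n \<Rightarrow> real ^ 'm \<Rightarrow> real"
    and g :: "real ^ 'm \<Rightarrow> real"
    and df :: "real ^ 'n \<Rightarrow> real ^ 'm \<Rightarrow> real ^ 'n"
    and dg :: "real ^ 'm \<Rightarrow> real ^ 'm"
    and Gf Gg \<eta>f \<eta>g L\<theta> \<gamma>f \<gamma>g qx q\<theta> qg q :: real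
    and x :: "nat \<Rightarrow> real ^ 'n" and \<theta> :: "nat \<Rightarrow> real ^ 'm"
    and xs :: "real ^ 'n" and \<theta>s :: "real ^ 'm"
  assumes X: "X \<noteq> {}" "closed X" "convex X"
    and \<Theta>: "\<Theta> \<noteq> {}" "closed \<Theta>" "convex \<Theta>"
    and f_convex: "\<And>t. t \<in> \<Theta> \<Longrightarrow> convex_on X (\<lambda>u. f u t)"
    and g_convex: "convex_on UNIV g"
    and f_C1: "\<And>t. t \<in> \<Theta> \<Longrightarrow> C1_gradient_on (\<lambda>u. f u t) (\<lambda>u. df u t) X"
    and g_C1: "C1_gradient_on g dg UNIV"
    and Gf_pos: "Gf > 0" and Gg_pos: "Gg > 0"
    and f_lipschitz: "\<And>u v t. u \<in> X \<Longrightarrow> v \<in> X \<Longrightarrow> t \<in> \<Theta> \<Longrightarrow>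
          norm (df u t - df v t) \<le> Gf * norm (u - v)"
    and g_lipschitz: "Gg-lipschitz_on \<Theta> dg"
    and \<eta>f_pos: "\<eta>f > 0" and \<eta>g_pos: "\<eta>g > 0"
    and f_strong: "\<And>t. t \<in> \<Theta> \<Longrightarrow> strongly_convex_on \<eta>f (\<lambda>u. f u t) (\<lambda>u. df u t) X"
    and g_strong: "strongly_convex_on \<eta>g g dg \<Theta>"
    and \<theta>s: "is_arg_min g (\<lambda>t. t \<in> \<Theta>) \<theta>s"
    and xs: "is_arg_min (\<lambda>u. f u \<theta>s) (\<lambda>u. u \<in> X) xs"
    and df_lipschitz: "L\<theta>-lipschitz_on \<Theta> (\<lambda>t. df xs t)"
    and \<gamma>f: "0 < \<gamma>f" "\<gamma>f < 2 / Gf"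
    and \<gamma>g: "0 < \<gamma>g" "\<gamma>g < 2 / Gg"
    and scheme: "joint_gradient_scheme X \<Theta> df dg (\<lambda>k. \<gamma>f) (\<lambda>k. \<gamma>g) x \<theta>"
    and qx: "qx = sqrt (1 - \<gamma>f * \<eta>f * (2 - \<gamma>f * Gf))"
    and q\<theta>: "q\<theta> = \<gamma>f * L\<theta>"
    and qg: "qg = sqrt (1 - \<gamma>g * \<eta>g * (2 - \<gamma>g * Gg))"
    and q: "q = max qx qg"
  shows "\<forall>k. norm (x (k + 1) - xs) \<le>
           qx ^ (k + 1) * norm (x 0 - xs) + real (k + 1) * q\<theta> * q ^ k * norm (\<theta> 0 - \<theta>s)"
proof
  fix k
  have scheme': "x 0 \<in> X" "\<theta> 0 \<in> \<Theta>"
    "x (Suc k) = closest_point X (x k - \<gamma>f *\<^sub>R df (x k) (\<theta> k))"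
    "\<theta> (Suc k) = closest_point \<Theta> (\<theta> k - \<gamma>g *\<^sub>R dg (\<theta> k))" for k
    using scheme unfolding joint_gradient_scheme_def by auto
  have xX: "x k \<in> X" for k
    by (cases k) (auto simp: scheme' intro: closest_point_in_set[OF X(2,1)])
  have \<theta>\<Theta>: "\<theta> k \<in> \<Theta>" for k
    by (cases k) (auto simp: scheme' intro: closest_point_in_set[OF \<Theta>(2,1)])
  have xsX: "xs \<in> X" and \<theta>s\<Theta>: "\<theta>s \<in> \<Theta>" using xs \<theta>s by (auto simp: is_arg_min_def)
  have f_lip: "Gf-lipschitz_on X (\<lambda>u. df u t)" if "t \<in> \<Theta>" for t
    by (rule lipschitz_onI) (use f_lipschitz that Gf_pos in \<open>auto simp: dist_norm\<close>)
  have f_grad: "has_gradient_on (\<lambda>u. f u t) (\<lambda>u. df u t) X" if "t \<in> \<Theta>" for t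
    using f_strong[OF that] by (simp add: strongly_convex_on_def)
  have g_grad: "has_gradient_on g dg \<Theta>"
    using g_strong by (simp add: strongly_convex_on_def)
  have vi_x: "0 \<le> df xs \<theta>s \<bullet> (v - xs)" if "v \<in> X" for v
    by (rule minimizer_variational_inequality[OF f_grad[OF \<theta>s\<Theta>] X(3) f_lip[OF \<theta>s\<Theta>] xs that])
  have vi_\<theta>: "0 \<le> dg \<theta>s \<bullet> (v - \<theta>s)" if "v \<in> \<Theta>" for v
    by (rule minimizer_variational_inequality[OF g_grad \<Theta>(3) g_lipschitz \<theta>s that])
  have L: "0 \<le> L\<theta>" using df_lipschitz by (rule lipschitz_on_nonneg)
  have x_step: "norm (x (Suc k) - xs) \<le> qx * norm (x k - xs) + q\<theta> * norm (\<theta> k - \<theta>s)" for k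
  proof -
    \<comment> \<open>The step uses the gradient at parameter \<open>\<theta> k\<close>, while
      \<open>xs\<close> is certified by \<open>c = df xs \<theta>s\<close>; Lipschitz continuity in
      the parameter bounds the mismatch.\<close>
    have "norm (x (Suc k) - xs) \<le> qx * norm (x k - xs) + \<gamma>f * norm (df xs (\<theta> k) - df xs \<theta>s)"
      unfolding scheme'(3) qx
      by (rule projected_step_bound[OF X(3,2) f_strong[OF \<theta>\<Theta>] f_lip[OF \<theta>\<Theta>]
            \<eta>f_pos Gf_pos \<gamma>f xX xsX vi_x])
    moreover have "\<gamma>f * norm (df xs (\<theta> k) - df xs \<theta>s) \<le> \<gamma>f * (L\<theta> * norm (\<theta> k - \<theta>s))"
      using lipschitz_onD[OF df_lipschitz \<theta>\<Theta> \<theta>s\<Theta>] \<gamma>f(1)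
      by (intro mult_left_mono) (auto simp: dist_norm)
    ultimately show ?thesis by (simp add: q\<theta>)
  qed
  have \<theta>_step: "norm (\<theta> (Suc k) - \<theta>s) \<le> qg * norm (\<theta> k - \<theta>s)" for k
    \<comment> \<open>Here \<open>c\<close> is \<open>dg \<theta>s\<close> itself, so the mismatch
      term is zero.\<close>
    using projected_step_bound[OF \<Theta>(3,2) g_strong g_lipschitz \<eta>g_pos Gg_pos \<gamma>g \<theta>\<Theta> \<theta>s\<Theta> vi_\<theta>]
    unfolding scheme'(4) qg by simp
  \<comment> \<open>An iterate other than \<open>xs\<close> provides the two distinct points of
    \<open>X\<close> that make the radicand nonnegative.\<close>
  have qx_sign: "0 \<le> qx \<or> (\<forall>k. norm (x k - xs) = 0)"
    using contraction_factor_nonneg[OF f_strong[OF \<theta>s\<Theta>] f_lip[OF \<theta>s\<Theta>] Gf_pos \<gamma>f xX xsX]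
    unfolding qx by auto
  have qg_sign: "0 \<le> qg \<or> norm (\<theta> 0 - \<theta>s) = 0"
    using contraction_factor_nonneg[OF g_strong g_lipschitz Gg_pos \<gamma>g \<theta>\<Theta> \<theta>s\<Theta>]
    unfolding qg by auto
  have "0 \<le> q\<theta>" using L \<gamma>f(1) by (simp add: q\<theta>)
  from coupled_recursion_bound[of "\<lambda>k. norm (x k - xs)" "\<lambda>k. norm (\<theta> k - \<theta>s)",
      OF norm_ge_zero norm_ge_zero this x_step \<theta>_step qx_sign qg_sign q, of k]
  show "norm (x (k + 1) - xs) \<le>
      qx ^ (k + 1) * norm (x 0 - xs) + real (k + 1) * q\<theta> * q ^ k * norm (\<theta> 0 - \<theta>s)"
    by simp
qed

end
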